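(* Let $\theta\in\mathbb{R}$, let $\mathcal{A}$ be the 2-dimensional quantum torus $C^*$-algebra generated by unitaries $U,V$ with $UV=e^{i\theta}VU$, and let $k_1,k_2\in\mathbb{Z}$. For every $a\in\mathcal{A}$, the first order form obtained by taking $U^{k_1}V^{k_2}$ as the differential basis is $$\delta_{U^{k_1}V^{k_2}}a=U^{k_1}V^{k_2}\bigl(a-\hat\theta_{-k_2\theta,\,k_1\theta}(a)\bigr)\,d(U^{k_1}V^{k_2})+(U^{k_1}V^{k_2})^*\bigl(a-\hat\theta_{k_2\theta,\,-k_1\theta}(a)\bigr)\,d(U^{k_1}V^{k_2})^*.$$
   Context: For $(s,t)\in\mathbb{R}^2$, $\hat\theta_{s,t}$ is the automorphism of $\mathcal{A}$ determined by $\hat\theta_{s,t}(U^kV^l)=e^{-i(sk+tl)}U^kV^l$ for $k,l\in\mathbb{Z}$; thus $\hat\theta_{-k_2\theta,k_1\theta}$ sends $U\mapsto e^{ik_2\theta}U$ and $V\mapsto e^{-ik_1\theta}V$. For an element $X\in\mathcal{A}$ commuting with $X^*$, the first order form with differential basis $X$ is $\delta_Xa=[X,a]\,dX+[X^*,a]\,dX^*$, where $[x,y]=xy-yx$ and $dX,dX^*$ are formal basis symbols of the free left $\mathcal{A}$-module $\mathcal{A}\,dX\oplus\mathcal{A}\,dX^*$. Equality of forms means equality of the coefficients of $dX$ and of $dX^*$. *)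

theory Defs
  imports "HOL-Analysis.Analysis" "HOL-Algebra.Ring"
begin

class scaleC =
  fixes scaleC :: "complex \<Rightarrow> 'a \<Rightarrow> 'a"  (infixr "*\<^sub>C" 75)

class star =
  fixes star :: "'a \<Rightarrow> 'a"

class cstar_algebra = real_normed_algebra_1 + banach + scaleC + star +
  assumes scaleC_add_right: "c *\<^sub>C (x + y) = c *\<^sub>C x + c *\<^sub>C y"
    and scaleC_add_left: "(c + d) *\<^sub>C x = c *\<^sub>C x + d *\<^sub>C x"
    and scaleC_scaleC: "c *\<^sub>C d *\<^sub>C x = (c * d) *\<^sub>C x"
    and scaleC_of_real: "complex_of_real r *\<^sub>C x = r *\<^sub>R x"
    and mult_scaleC_left: "(c *\<^sub>C x) * y = c *\<^sub>C (x * y)"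
    and mult_scaleC_right: "x * (c *\<^sub>C y) = c *\<^sub>C (x * y)"
    and norm_scaleC: "norm (c *\<^sub>C x) = cmod c * norm x"
    and star_star: "star (star x) = x"
    and star_add: "star (x + y) = star x + star y"
    and star_mult: "star (x * y) = star y * star x"
    and star_scaleC: "star (c *\<^sub>C x) = cnj c *\<^sub>C star x"
    and cstar_identity: "norm (star x * x) = (norm x)\<^sup>2"

text \<open>
  The universal property of the quantum torus quantifies over C*-algebras, so these are also
  needed as objects: structures whose carrier is a subset of a type.
\<close>

record 'b cstar_structure = "'b ring" +
  scal :: "complex \<Rightarrow> 'b \<Rightarrow> 'b"
  adj :: "'b \<Rightarrow> 'b"
  nrm :: "'b \<Rightarrow> real"

locale cstar_algebra_on = ring B for B :: "'b cstar_structure" (structure) +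
  assumes scal_closed: "x \<in> carrier B \<Longrightarrow> scal B c x \<in> carrier B"
    and scal_add_right: "\<lbrakk>x \<in> carrier B; y \<in> carrier B\<rbrakk> \<Longrightarrow>
          scal B c (x \<oplus> y) = scal B c x \<oplus> scal B c y"
    and scal_add_left: "x \<in> carrier B \<Longrightarrow> scal B (c + d) x = scal B c x \<oplus> scal B d x"
    and scal_scal: "x \<in> carrier B \<Longrightarrow> scal B c (scal B d x) = scal B (c * d) x"
    and scal_one: "x \<in> carrier B \<Longrightarrow> scal B 1 x = x"
    and mult_scal_left: "\<lbrakk>x \<in> carrier B; y \<in> carrier B\<rbrakk> \<Longrightarrow>
          scal B c x \<otimes> y = scal B c (x \<otimes> y)"
    and mult_scal_right: "\<lbrakk>x \<in> carrier B; y \<in> carrier B\<rbrakk> \<Longrightarrow>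
          x \<otimes> scal B c y = scal B c (x \<otimes> y)"
    and adj_closed: "x \<in> carrier B \<Longrightarrow> adj B x \<in> carrier B"
    and adj_adj: "x \<in> carrier B \<Longrightarrow> adj B (adj B x) = x"
    and adj_add: "\<lbrakk>x \<in> carrier B; y \<in> carrier B\<rbrakk> \<Longrightarrow> adj B (x \<oplus> y) = adj B x \<oplus> adj B y"
    and adj_mult: "\<lbrakk>x \<in> carrier B; y \<in> carrier B\<rbrakk> \<Longrightarrow> adj B (x \<otimes> y) = adj B y \<otimes> adj B x"
    and adj_scal: "x \<in> carrier B \<Longrightarrow> adj B (scal B c x) = scal B (cnj c) (adj B x)"
    and nrm_nonneg: "x \<in> carrier B \<Longrightarrow> 0 \<le> nrm B x"
    and nrm_eq_0: "x \<in> carrier B \<Longrightarrow> nrm B x = 0 \<longleftrightarrow> x = \<zero>"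
    and nrm_triangle: "\<lbrakk>x \<in> carrier B; y \<in> carrier B\<rbrakk> \<Longrightarrow> nrm B (x \<oplus> y) \<le> nrm B x + nrm B y"
    and nrm_scal: "x \<in> carrier B \<Longrightarrow> nrm B (scal B c x) = cmod c * nrm B x"
    and nrm_mult: "\<lbrakk>x \<in> carrier B; y \<in> carrier B\<rbrakk> \<Longrightarrow> nrm B (x \<otimes> y) \<le> nrm B x * nrm B y"
    and nrm_adj_mult: "x \<in> carrier B \<Longrightarrow> nrm B (adj B x \<otimes> x) = (nrm B x)\<^sup>2"
    and nrm_complete: "\<And>X :: nat \<Rightarrow> 'b. \<lbrakk>\<And>n. X n \<in> carrier B;
          \<forall>e>0. \<exists>N. \<forall>m\<ge>N. \<forall>n\<ge>N. nrm B (X m \<ominus> X n) < e\<rbrakk> \<Longrightarrow>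
          \<exists>l\<in>carrier B. (\<lambda>n. nrm B (X n \<ominus> l)) \<longlonglongrightarrow> 0"

definition cstar_UNIV :: "'a::cstar_algebra cstar_structure"
  where "cstar_UNIV = \<lparr>carrier = UNIV, mult = (*), one = 1, zero = 0, add = (+),
           scal = scaleC, adj = star, nrm = norm\<rparr>"

lemma ring_cstar_UNIV: "ring (cstar_UNIV :: 'a::cstar_algebra cstar_structure)"
proof (rule ringI)
  show "abelian_group (cstar_UNIV :: 'a cstar_structure)"
  proof (rule abelian_groupI)
    fix x :: 'a
    show "\<exists>y\<in>carrier cstar_UNIV. y \<oplus>\<^bsub>cstar_UNIV\<^esub> x = \<zero>\<^bsub>cstar_UNIV\<^esub>"
      by (rule bexI[of _ "- x"]) (auto simp: cstar_UNIV_def)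
  qed (auto simp: cstar_UNIV_def add.assoc add.commute)
  show "Group.monoid (cstar_UNIV :: 'a cstar_structure)"
    by (rule monoidI) (auto simp: cstar_UNIV_def mult.assoc)
qed (auto simp: cstar_UNIV_def distrib_left distrib_right)

lemma minus_cstar_UNIV: "x \<ominus>\<^bsub>cstar_UNIV\<^esub> y = x - y"
proof -
  interpret ring "cstar_UNIV :: 'a cstar_structure" by (rule ring_cstar_UNIV)
  have "\<ominus>\<^bsub>cstar_UNIV\<^esub> y = - y"
    by (rule minus_equality) (auto simp: cstar_UNIV_def)
  then show ?thesis by (simp add: a_minus_def) (simp add: cstar_UNIV_def)
qed

lemma cstar_algebra_on_UNIV:
  "cstar_algebra_on (cstar_UNIV :: 'a::cstar_algebra cstar_structure)"
proof (intro cstar_algebra_on.intro cstar_algebra_on_axioms.intro)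
  show "ring (cstar_UNIV :: 'a cstar_structure)" by (rule ring_cstar_UNIV)
next
  fix X :: "nat \<Rightarrow> 'a"
  assume *: "\<forall>e>0. \<exists>N. \<forall>m\<ge>N. \<forall>n\<ge>N. nrm cstar_UNIV (X m \<ominus>\<^bsub>cstar_UNIV\<^esub> X n) < e"
  have "Cauchy X"
    using * unfolding Cauchy_def dist_norm minus_cstar_UNIV by (simp add: cstar_UNIV_def)
  then obtain l where "X \<longlonglongrightarrow> l" using Cauchy_convergent convergent_def by blast
  then show "\<exists>l\<in>carrier cstar_UNIV. (\<lambda>n. nrm cstar_UNIV (X n \<ominus>\<^bsub>cstar_UNIV\<^esub> l)) \<longlonglongrightarrow> 0"
    unfolding minus_cstar_UNIV
    by (auto simp: cstar_UNIV_def tendsto_norm_zero_iff LIM_zero_iff)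
next
  fix x :: 'a
  show "scal cstar_UNIV 1 x = x"
    using scaleC_of_real[of 1 x] by (simp add: cstar_UNIV_def)
qed (auto simp: cstar_UNIV_def scaleC_add_right scaleC_add_left scaleC_scaleC mult_scaleC_left
    mult_scaleC_right norm_scaleC star_star star_add star_mult star_scaleC cstar_identity
    norm_triangle_ineq norm_mult_ineq)

definition star_hom_into :: "'b cstar_structure \<Rightarrow> ('a::cstar_algebra \<Rightarrow> 'b) \<Rightarrow> bool"
  where "star_hom_into B \<phi> \<longleftrightarrow>
    (\<forall>x. \<phi> x \<in> carrier B) \<and>
    (\<forall>x y. \<phi> (x + y) = \<phi> x \<oplus>\<^bsub>B\<^esub> \<phi> y) \<and>
    (\<forall>x y. \<phi> (x * y) = \<phi> x \<otimes>\<^bsub>B\<^esub> \<phi> y) \<and>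
    (\<forall>c x. \<phi> (c *\<^sub>C x) = scal B c (\<phi> x)) \<and>
    (\<forall>x. \<phi> (star x) = adj B (\<phi> x)) \<and>
    \<phi> 1 = \<one>\<^bsub>B\<^esub>"

definition star_automorphism :: "('a::cstar_algebra \<Rightarrow> 'a) \<Rightarrow> bool"
  where "star_automorphism \<phi> \<longleftrightarrow> star_hom_into cstar_UNIV \<phi> \<and> bij \<phi>"

definition star_subalgebra :: "'a::cstar_algebra set \<Rightarrow> bool"
  where "star_subalgebra S \<longleftrightarrow>
    1 \<in> S \<and>
    (\<forall>x\<in>S. \<forall>y\<in>S. x + y \<in> S \<and> x * y \<in> S) \<and>
    (\<forall>c. \<forall>x\<in>S. c *\<^sub>C x \<in> S) \<and>
    (\<forall>x\<in>S. star x \<in> S)"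

definition unitary_in :: "'b cstar_structure \<Rightarrow> 'b \<Rightarrow> bool"
  where "unitary_in B u \<longleftrightarrow>
    u \<in> carrier B \<and> adj B u \<otimes>\<^bsub>B\<^esub> u = \<one>\<^bsub>B\<^esub> \<and> u \<otimes>\<^bsub>B\<^esub> adj B u = \<one>\<^bsub>B\<^esub>"

text \<open>
  The type \<^typ>\<open>'a\<close> is the universal C*-algebra generated by unitaries \<open>U\<close>, \<open>V\<close> with
  \<open>U V = e\<^sup>i\<^sup>\<theta> V U\<close>. HOL cannot quantify over all types inside the universal property, and it
  suffices to test it on C*-algebras \<open>B\<close> carried by subsets of \<^typ>\<open>'a\<close> itself: a C*-algebra
  generated by two elements has at most the cardinality of the continuum, whereas \<^typ>\<open>'a\<close>, a
  nonzero complex vector space, has at least that cardinality. Uniqueness of the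
  homomorphism follows from generation.
\<close>

locale quantum_torus =
  fixes \<theta> :: real and U V :: "'a::cstar_algebra"
  assumes unitary_U: "unitary_in cstar_UNIV U"
    and unitary_V: "unitary_in cstar_UNIV V"
    and commutation: "U * V = cis \<theta> *\<^sub>C (V * U)"
    and generated: "(\<lambda>S. closed S \<and> star_subalgebra S) hull {U, V} = UNIV"
    and universal: "\<And>(B :: 'a cstar_structure) u v.
          \<lbrakk>cstar_algebra_on B; unitary_in B u; unitary_in B v;
           u \<otimes>\<^bsub>B\<^esub> v = scal B (cis \<theta>) (v \<otimes>\<^bsub>B\<^esub> u)\<rbrakk> \<Longrightarrow>
          \<exists>\<phi>. star_hom_into B \<phi> \<and> \<phi> U = u \<and> \<phi> V = v"

text \<open>Integer powers of a unitary, whose inverse is its adjoint.\<close>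

definition unitary_power :: "'a::cstar_algebra \<Rightarrow> int \<Rightarrow> 'a"  (infixr "^\<^sub>u" 80)
  where "u ^\<^sub>u k = (if k \<ge> 0 then u ^ nat k else star u ^ nat (- k))"

text \<open>
  For a quantum torus the automorphism exists by universality and is unique, since
  *-homomorphisms of C*-algebras are automatically continuous and the span of the monomials
  is dense.
\<close>

definition torus_action ::
    "'a::cstar_algebra \<Rightarrow> 'a \<Rightarrow> real \<Rightarrow> real \<Rightarrow> 'a \<Rightarrow> 'a"
  where "torus_action U V s t =
    (THE \<phi>. star_automorphism \<phi> \<and>
       (\<forall>k l :: int. \<phi> (U ^\<^sub>u k * V ^\<^sub>u l) =
          cis (- (s * real_of_int k + t * real_of_int l)) *\<^sub>C (U ^\<^sub>u k * V ^\<^sub>u l)))"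

text \<open>
  The free left module on the two formal symbols \<open>dX\<close> and \<open>dX\<^sup>*\<close> is represented by the pairs
  of coefficients; the symbols are its standard basis.
\<close>

type_synonym 'a form = "'a \<times> 'a"

definition form_scale :: "'a::cstar_algebra \<Rightarrow> 'a form \<Rightarrow> 'a form"  (infixr "\<bullet>\<^sub>f" 75)
  where "a \<bullet>\<^sub>f \<omega> = (a * fst \<omega>, a * snd \<omega>)"

definition d_basis :: "'a::cstar_algebra form"
  where "d_basis = (1, 0)"

definition d_basis_star :: "'a::cstar_algebra form"
  where "d_basis_star = (0, 1)"

definition commutator :: "'a::cstar_algebra \<Rightarrow> 'a \<Rightarrow> 'a"
  where "commutator x y = x * y - y * x"

definition first_order_form :: "'a::cstar_algebra \<Rightarrow> 'a \<Rightarrow> 'a form"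
  where "first_order_form X a =
    commutator X a \<bullet>\<^sub>f d_basis + commutator (star X) a \<bullet>\<^sub>f d_basis_star"

end

theory Submission
  imports Defs
begin

text \<open>
  Conjugation by the unitary \<open>W = U\<^bsup>k\<^sub>1\<^esup> V\<^bsup>k\<^sub>2\<^esup>\<close> multiplies \<open>U\<close> and \<open>V\<close> by phases, so it is the
  required torus automorphism provided the latter is unique; then
  \<open>W (a - W\<^sup>* a W) = W a - a W\<close>. Uniqueness needs the continuity of unital *-homomorphisms.
  That follows without spectral theory: if \<open>a\<close> is self-adjoint with norm less than 1, then
  \<open>u = a + i (1 - a\<^sup>2)\<^bsup>1/2\<^esup>\<close> is unitary with \<open>2 a = u + u\<^sup>*\<close>, the square root being given by the
  binomial series; a homomorphism preserves unitaries, hence maps \<open>a\<close> into the unit ball.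
\<close>

section \<open>Square roots by the binomial series in a Banach algebra\<close>

lemma convolution_gchoose_half:
  "(\<Sum>i\<le>n. ((1/2 :: real) gchoose i) * ((1/2) gchoose (n - i))) = of_nat (1 choose n)"
  using gbinomial_Vandermonde[of "1/2 :: real" "1/2" n]
  by (simp add: atLeast0AtMost binomial_gbinomial)

definition binomial_sqrt :: "'a::{real_normed_algebra_1,banach} \<Rightarrow> 'a"
  where "binomial_sqrt z = (\<Sum>n. ((1/2 :: real) gchoose n) *\<^sub>R z ^ n)"

lemma summable_norm_binomial_sqrt:
  fixes z :: "'a::{real_normed_algebra_1,banach}"
  assumes "norm z < 1"
  shows "summable (\<lambda>n. norm (((1/2 :: real) gchoose n) *\<^sub>R z ^ n))"
proof (rule summable_comparison_test')
  \<comment> \<open>The scalar series converges at a point \<open>r\<close> strictly between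
    \<open>norm z\<close> and 1, hence absolutely at \<open>norm z\<close>.\<close>
  obtain r where r: "norm z < r" "r < 1" using assms dense by blast
  then have "0 < r" using norm_ge_zero[of z] by linarith
  with r have "summable (\<lambda>n. ((1/2 :: real) gchoose n) * r ^ n)"
    using gen_binomial_real[of r "1/2"] by (simp add: sums_iff)
  then show "summable (\<lambda>n. norm (((1/2 :: real) gchoose n) * norm z ^ n))"
    by (rule powser_insidea) (use r \<open>0 < r\<close> in simp)
  show "norm (norm (((1/2 :: real) gchoose n) *\<^sub>R z ^ n))
      \<le> norm (((1/2 :: real) gchoose n) * norm z ^ n)" for n
    by (simp add: abs_mult mult_left_mono norm_power_ineq)
qed

lemma binomial_sqrt_mult_self:
  fixes z :: "'a::{real_normed_algebra_1,banach}"
  assumes "norm z < 1"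
  shows "binomial_sqrt z * binomial_sqrt z = 1 + z"
proof -
  let ?c = "\<lambda>n. (1/2 :: real) gchoose n"
  note s = summable_norm_binomial_sqrt[OF assms]
  have "binomial_sqrt z * binomial_sqrt z
      = (\<Sum>n. \<Sum>i\<le>n. (?c i *\<^sub>R z ^ i) * (?c (n - i) *\<^sub>R z ^ (n - i)))"
    unfolding binomial_sqrt_def by (rule Cauchy_product[OF s s])
  \<comment> \<open>The coefficients convolve by Vandermonde with 1/2 + 1/2 = 1, so the product is
    the binomial series with exponent 1, which stops after the linear term.\<close>
  also have "\<dots> = (\<Sum>n. real (1 choose n) *\<^sub>R z ^ n)"
  proof (rule suminf_cong)
    fix n
    have "(\<Sum>i\<le>n. (?c i *\<^sub>R z ^ i) * (?c (n - i) *\<^sub>R z ^ (n - i)))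
        = (\<Sum>i\<le>n. (?c i * ?c (n - i)) *\<^sub>R z ^ n)"
      by (rule sum.cong) (auto simp flip: power_add)
    then show "(\<Sum>i\<le>n. (?c i *\<^sub>R z ^ i) * (?c (n - i) *\<^sub>R z ^ (n - i)))
        = real (1 choose n) *\<^sub>R z ^ n"
      by (simp only: scaleR_sum_left[symmetric] convolution_gchoose_half)
  qed
  also have "\<dots> = (\<Sum>n<2. real (1 choose n) *\<^sub>R z ^ n)"
    by (rule suminf_finite) (auto simp: not_less intro!: binomial_eq_0)
  also have "\<dots> = 1 + z" by (simp add: numeral_2_eq_2)
  finally show ?thesis .
qed

lemma binomial_sqrt_commute:
  fixes z :: "'a::{real_normed_algebra_1,banach}"
  assumes "norm z < 1" and "x * z = z * x"
  shows "x * binomial_sqrt z = binomial_sqrt z * x"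
proof -
  note s = summable_norm_cancel[OF summable_norm_binomial_sqrt[OF assms(1)]]
  have "x * z ^ n = z ^ n * x" for n
    using power_commuting_commutes[OF assms(2)[symmetric], of n] by simp
  then show ?thesis
    unfolding binomial_sqrt_def suminf_mult[OF s, symmetric] suminf_mult2[OF s] by simp
qed

section \<open>Scalars, adjoints and unitaries in a C*-algebra\<close>

lemma scaleC_one [simp]: "1 *\<^sub>C x = (x::'a::cstar_algebra)"
  using scaleC_of_real[of 1 x] by simp

lemma scaleC_zero_left [simp]: "0 *\<^sub>C x = (0::'a::cstar_algebra)"
  using scaleC_of_real[of 0 x] by simp

lemma star_scaleR: "star (r *\<^sub>R x :: 'a::cstar_algebra) = r *\<^sub>R star x"
  by (simp flip: scaleC_of_real add: star_scaleC)

lemma star_one [simp]: "star 1 = (1::'a::cstar_algebra)"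
  by (metis mult_1_left mult_1_right star_mult star_star)

lemma star_diff: "star (x - y :: 'a::cstar_algebra) = star x - star y"
  by (metis add_diff_cancel diff_add_cancel star_add)

lemma star_power: "star (x ^ n :: 'a::cstar_algebra) = star x ^ n"
  by (induction n) (simp_all add: star_mult power_commutes)

text \<open>The C*-identity and submultiplicativity bound the square of \<open>norm y\<close> by
  \<open>norm (star y) * norm y\<close>. Cancelling \<open>norm y\<close> gives one inequality, and
  \<open>y = star x\<close> gives the other.\<close>

lemma norm_star: "norm (star x :: 'a::cstar_algebra) = norm x"
proof -
  have le: "norm y \<le> norm (star y)" for y :: 'a
  proof (cases "norm y = 0")
    case False
    have "norm y * norm y \<le> norm (star y) * norm y"
      using norm_mult_ineq[of "star y" y] by (simp add: cstar_identity power2_eq_square)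
    with False show ?thesis
      using norm_ge_zero[of y] by (simp add: mult_le_cancel_right)
  qed simp
  show ?thesis using le[of x] le[of "star x"] by (simp add: star_star)
qed

lemma bounded_linear_star: "bounded_linear (star :: 'a::cstar_algebra \<Rightarrow> 'a)"
  by (rule bounded_linear_intro[where K = 1]) (simp_all add: star_add star_scaleR norm_star)

text \<open>The adjoint is continuous, so it acts termwise, and the coefficients are real.\<close>

lemma star_binomial_sqrt:
  fixes z :: "'a::cstar_algebra"
  assumes "norm z < 1" and "star z = z"
  shows "star (binomial_sqrt z) = binomial_sqrt z"
  using summable_norm_cancel[OF summable_norm_binomial_sqrt[OF assms(1)]]
  unfolding binomial_sqrt_def
  by (simp add: bounded_linear.suminf[OF bounded_linear_star] star_scaleR star_power assms(2))

definition unitary :: "'a::cstar_algebra \<Rightarrow> bool"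
  where "unitary u \<longleftrightarrow> star u * u = 1 \<and> u * star u = 1"

lemma unitary_in_cstar_UNIV: "unitary_in cstar_UNIV u \<longleftrightarrow> unitary u"
  by (simp add: unitary_in_def unitary_def cstar_UNIV_def)

lemma unitary_star: "unitary u \<Longrightarrow> unitary (star u)"
  by (simp add: unitary_def star_star)

lemma unitary_one: "unitary 1"
  by (simp add: unitary_def)

lemma unitary_mult:
  assumes "unitary u" and "unitary v"
  shows "unitary (u * v)"
  using assms unfolding unitary_def star_mult by (metis mult.assoc mult_1_left)

lemma unitary_pow: "unitary u \<Longrightarrow> unitary (u ^ n)"
  by (induction n) (simp_all add: unitary_one unitary_mult)

lemma unitary_unitary_power: "unitary u \<Longrightarrow> unitary (u ^\<^sub>u k)"
  by (simp add: unitary_power_def unitary_pow unitary_star)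

lemma norm_unitary:
  assumes "unitary u"
  shows "norm u = 1"
proof -
  have "(norm u)\<^sup>2 = 1\<^sup>2"
    using cstar_identity[of u] assms by (simp add: unitary_def)
  then show ?thesis by (rule power2_eq_imp_eq) simp_all
qed

section \<open>Contractivity and continuity of unital *-endomorphisms\<close>

lemma selfadjoint_real_part_of_unitary:
  fixes a :: "'a::cstar_algebra"
  assumes a: "star a = a" and "norm a < 1"
  obtains u where "unitary u" and "a + a = u + star u"
proof -
  define b where "b = binomial_sqrt (- (a * a))"
  have "norm a * norm a < 1"
    using mult_strict_mono[OF assms(2) assms(2)] by simp
  then have lt: "norm (- (a * a)) < 1"
    using norm_mult_ineq[of a a] by simp
  have sa: "star (- (a * a)) = - (a * a)"
    using star_diff[of 0 "a * a"] star_diff[of 0 0] by (simp add: star_mult a)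
  have bb: "b * b = 1 - a * a"
    unfolding b_def using binomial_sqrt_mult_self[OF lt] by simp
  have ab: "a * b = b * a"
    unfolding b_def by (rule binomial_sqrt_commute[OF lt]) (simp add: mult.assoc)
  have b: "star b = b"
    unfolding b_def by (rule star_binomial_sqrt[OF lt sa])
  \<comment> \<open>\<open>c\<close> is skew-adjoint and commutes with \<open>a\<close>, so both
    unitarity products of \<open>a + c\<close> reduce to \<open>a * a - c * c\<close>, which is
    1.\<close>
  define c where "c = \<i> *\<^sub>C b"
  have "\<i> *\<^sub>C b + (- \<i>) *\<^sub>C b = 0"
    by (simp flip: scaleC_add_left)
  then have c: "star c = - c"
    by (simp add: c_def star_scaleC b add_eq_0_iff)
  have "(-1 :: complex) *\<^sub>C (b * b) = - (b * b)"
    using scaleC_of_real[of "-1" "b * b"] by simp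
  then have cc: "c * c = a * a - 1"
    by (simp add: c_def mult_scaleC_left mult_scaleC_right scaleC_scaleC bb)
  have ac: "a * c = c * a"
    by (simp add: c_def mult_scaleC_left mult_scaleC_right ab)
  show thesis
  proof
    show "unitary (a + c)"
      by (simp add: unitary_def star_add a c algebra_simps cc ac)
    show "a + a = (a + c) + star (a + c)"
      by (simp add: star_add a c)
  qed
qed

locale star_endomorphism =
  fixes \<phi> :: "'a::cstar_algebra \<Rightarrow> 'a"
  assumes star_hom: "star_hom_into cstar_UNIV \<phi>"
begin

lemma hom_add: "\<phi> (x + y) = \<phi> x + \<phi> y"
  and hom_mult: "\<phi> (x * y) = \<phi> x * \<phi> y"
  and hom_scaleC: "\<phi> (c *\<^sub>C x) = c *\<^sub>C \<phi> x"
  and hom_star: "\<phi> (star x) = star (\<phi> x)"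
  and hom_one: "\<phi> 1 = 1"
  using star_hom by (simp_all add: star_hom_into_def cstar_UNIV_def)

lemma hom_scaleR: "\<phi> (r *\<^sub>R x) = r *\<^sub>R \<phi> x"
  by (simp flip: scaleC_of_real add: hom_scaleC)

lemma hom_power: "\<phi> (x ^ n) = \<phi> x ^ n"
  by (induction n) (simp_all add: hom_mult hom_one)

lemma hom_unitary_power: "\<phi> (u ^\<^sub>u k) = \<phi> u ^\<^sub>u k"
  by (simp add: unitary_power_def hom_power hom_star)

lemma hom_unitary: "unitary u \<Longrightarrow> unitary (\<phi> u)"
  unfolding unitary_def by (metis hom_mult hom_one hom_star)

lemma norm_hom_selfadjoint_le_1:
  assumes "star a = a" and "norm a < 1"
  shows "norm (\<phi> a) \<le> 1"
proof -
  obtain u where u: "unitary u" "a + a = u + star u"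
    using selfadjoint_real_part_of_unitary[OF assms] .
  have "2 *\<^sub>R \<phi> a = \<phi> u + star (\<phi> u)"
    by (metis hom_add hom_star scaleR_2 u(2))
  then have "2 * norm (\<phi> a) = norm (\<phi> u + star (\<phi> u))"
    by (metis abs_numeral norm_scaleR)
  also have "\<dots> \<le> norm (\<phi> u) + norm (star (\<phi> u))"
    by (rule norm_triangle_ineq)
  also have "\<dots> = 2"
    using norm_unitary[OF hom_unitary[OF u(1)]] by (simp add: norm_star)
  finally show ?thesis by simp
qed

text \<open>Rescaling by any \<open>r > norm a\<close> lands in the open unit ball; then
  \<open>r\<close> tends to \<open>norm a\<close>.\<close>

lemma norm_hom_selfadjoint_le:
  assumes "star a = a"
  shows "norm (\<phi> a) \<le> norm a"
proof (rule dense_ge)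
  fix r assume r: "norm a < r"
  then have "0 < r" using norm_ge_zero[of a] by linarith
  have "norm (\<phi> ((1 / r) *\<^sub>R a)) \<le> 1"
    by (rule norm_hom_selfadjoint_le_1) (use r \<open>0 < r\<close> assms in \<open>simp_all add: star_scaleR\<close>)
  then show "norm (\<phi> a) \<le> r"
    using \<open>0 < r\<close> by (simp add: hom_scaleR field_simps)
qed

text \<open>The C*-identity on both sides reduces the bound to the self-adjoint element
  \<open>star x * x\<close>.\<close>

lemma norm_hom_le: "norm (\<phi> x) \<le> norm x"
proof (rule power2_le_imp_le)
  have "(norm (\<phi> x))\<^sup>2 = norm (\<phi> (star x * x))"
    by (simp add: cstar_identity hom_mult hom_star)
  also have "\<dots> \<le> norm (star x * x)"
    by (rule norm_hom_selfadjoint_le) (simp add: star_mult star_star)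
  finally show "(norm (\<phi> x))\<^sup>2 \<le> (norm x)\<^sup>2" by (simp add: cstar_identity)
qed simp

lemma continuous_on_hom: "continuous_on S \<phi>"
  by (rule linear_continuous_on, rule bounded_linear_intro[where K = 1])
    (simp_all add: hom_add hom_scaleR norm_hom_le)

end

text \<open>The set where the two maps agree is a *-subalgebra, closed by continuity, so it contains
  the hull of the generators.\<close>

lemma star_endomorphism_eqI:
  assumes "star_endomorphism \<phi>" and "star_endomorphism \<psi>"
    and gen: "(\<lambda>S. closed S \<and> star_subalgebra S) hull G = UNIV"
    and eq: "\<And>x. x \<in> G \<Longrightarrow> \<phi> x = \<psi> x"
  shows "\<phi> = \<psi>"
proof -
  interpret \<phi>: star_endomorphism \<phi> by fact
  interpret \<psi>: star_endomorphism \<psi> by fact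
  let ?S = "{x. \<phi> x = \<psi> x}"
  have "closed ?S"
    by (rule closed_Collect_eq[OF \<phi>.continuous_on_hom \<psi>.continuous_on_hom])
  moreover have "star_subalgebra ?S"
    by (simp add: star_subalgebra_def \<phi>.hom_one \<psi>.hom_one \<phi>.hom_add \<psi>.hom_add \<phi>.hom_mult
        \<psi>.hom_mult \<phi>.hom_scaleC \<psi>.hom_scaleC \<phi>.hom_star \<psi>.hom_star)
  ultimately have "(\<lambda>S. closed S \<and> star_subalgebra S) hull G \<subseteq> ?S"
    using eq by (intro hull_minimal) auto
  then show ?thesis unfolding gen by auto
qed

lemma star_automorphism_conj:
  assumes "unitary w"
  shows "star_automorphism (\<lambda>x. star w * x * w)"
proof -
  have w: "w * star w = 1" "star w * w = 1" using assms by (simp_all add: unitary_def)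
  \<comment> \<open>These cancel inside the right-nested products that \<open>mult.assoc\<close>
    produces.\<close>
  have w': "w * (star w * x) = x" "star w * (w * x) = x" for x
    by (simp_all add: w flip: mult.assoc)
  have "bij (\<lambda>x. star w * x * w)"
    by (rule bij_betw_byWitness[where f' = "\<lambda>x. w * x * star w"]) (auto simp: mult.assoc w w')
  then show ?thesis
    by (simp add: star_automorphism_def star_hom_into_def cstar_UNIV_def distrib_left distrib_right
        mult_scaleC_left mult_scaleC_right star_mult star_star mult.assoc w w')
qed

section \<open>Integer powers and commutation up to a phase\<close>

lemma unitary_power_0: "u ^\<^sub>u 0 = 1"
  and unitary_power_1: "u ^\<^sub>u 1 = u"
  by (simp_all add: unitary_power_def)

lemma cis_scaleC_power:
  fixes u :: "'a::cstar_algebra"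
  shows "(cis x *\<^sub>C u) ^ n = cis (of_nat n * x) *\<^sub>C u ^ n"
  by (induction n)
    (simp_all add: mult_scaleC_left mult_scaleC_right scaleC_scaleC cis_mult algebra_simps)

text \<open>For negative \<open>k\<close> two signs cancel: the adjoint conjugates the phase, and
  the exponent is \<open>nat (- k)\<close>.\<close>

lemma cis_scaleC_unitary_power:
  fixes u :: "'a::cstar_algebra"
  shows "(cis x *\<^sub>C u) ^\<^sub>u k = cis (of_int k * x) *\<^sub>C u ^\<^sub>u k"
  by (simp add: unitary_power_def star_scaleC cis_cnj cis_scaleC_power)

lemma phase_commute_power:
  fixes x y :: "'a::cstar_algebra"
  assumes "x * y = cis t *\<^sub>C (y * x)"
  shows "x * y ^ n = cis (of_nat n * t) *\<^sub>C (y ^ n * x)"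
proof (induction n)
  case (Suc n)
  have "x * y ^ Suc n = (x * y) * y ^ n" by (simp add: mult.assoc)
  also have "\<dots> = cis t *\<^sub>C (y * (x * y ^ n))"
    by (simp add: assms mult_scaleC_left mult.assoc)
  also have "\<dots> = cis (of_nat (Suc n) * t) *\<^sub>C (y ^ Suc n * x)"
    by (simp add: Suc.IH mult_scaleC_right scaleC_scaleC cis_mult algebra_simps)
  finally show ?case .
qed simp

lemma phase_commute_sym:
  fixes x y :: "'a::cstar_algebra"
  assumes "x * y = cis t *\<^sub>C (y * x)"
  shows "y * x = cis (- t) *\<^sub>C (x * y)"
  by (simp add: assms scaleC_scaleC cis_mult)

text \<open>Multiply the reversed relation for \<open>y * x\<close> by \<open>star y\<close> on both
  sides.\<close>

lemma phase_commute_star: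
  fixes x y :: "'a::cstar_algebra"
  assumes "unitary y" and "x * y = cis t *\<^sub>C (y * x)"
  shows "x * star y = cis (- t) *\<^sub>C (star y * x)"
proof -
  have y: "star y * y = 1" "y * star y = 1" using assms(1) by (simp_all add: unitary_def)
  have "x * star y = star y * (y * x) * star y"
    by (simp add: y flip: mult.assoc)
  also have "\<dots> = cis (- t) *\<^sub>C (star y * x * (y * star y))"
    unfolding phase_commute_sym[OF assms(2)]
    by (simp add: mult_scaleC_left mult_scaleC_right mult.assoc)
  finally show ?thesis by (simp add: y)
qed

text \<open>Negative powers of \<open>y\<close> are powers of \<open>star y\<close>, past which
  \<open>x\<close> moves with the opposite phase.\<close>

lemma phase_commute_unitary_power:
  fixes x y :: "'a::cstar_algebra"
  assumes "unitary y" and "x * y = cis t *\<^sub>C (y * x)"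
  shows "x * y ^\<^sub>u k = cis (of_int k * t) *\<^sub>C (y ^\<^sub>u k * x)"
  using phase_commute_power[OF assms(2), of "nat k"]
    phase_commute_power[OF phase_commute_star[OF assms], of "nat (- k)"]
  by (simp add: unitary_power_def)

lemma phase_commute_mult:
  fixes x y z :: "'a::cstar_algebra"
  assumes "x * y = cis s *\<^sub>C (y * x)" and "x * z = cis t *\<^sub>C (z * x)"
  shows "x * (y * z) = cis (s + t) *\<^sub>C (y * z * x)"
proof -
  have "x * (y * z) = cis s *\<^sub>C (y * (x * z))"
    by (simp add: assms(1) mult_scaleC_left flip: mult.assoc)
  then show ?thesis
    by (simp add: assms(2) mult_scaleC_right scaleC_scaleC cis_mult mult.assoc)
qed

section \<open>The torus action as conjugation by a unitary\<close>

context quantum_torus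
begin

text \<open>The two relations say that conjugation scales \<open>U\<close> and \<open>V\<close> by
  the phases of the action. Multiplicativity extends this to all monomials, and generation by
  \<open>U\<close> and \<open>V\<close> makes the automorphism unique.\<close>

lemma torus_action_eq_conj:
  assumes w: "unitary w"
    and Uw: "U * w = cis (- s) *\<^sub>C (w * U)" and Vw: "V * w = cis (- t) *\<^sub>C (w * V)"
  shows "torus_action U V s t = (\<lambda>x. star w * x * w)"
  unfolding torus_action_def
proof (rule the_equality, intro conjI allI)
  let ?\<psi> = "\<lambda>x. star w * x * w"
  show aut: "star_automorphism ?\<psi>" by (rule star_automorphism_conj[OF w])
  then interpret \<psi>: star_endomorphism ?\<psi>
    by (simp add: star_endomorphism_def star_automorphism_def)
  have ww: "star w * w = 1" using w by (simp add: unitary_def)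
  have U: "star w * U * w = cis (- s) *\<^sub>C U" and V: "star w * V * w = cis (- t) *\<^sub>C V"
    by (simp_all add: mult.assoc Uw Vw mult_scaleC_right)
      (simp_all add: ww flip: mult.assoc)
  show mono: "?\<psi> (U ^\<^sub>u k * V ^\<^sub>u l)
      = cis (- (s * real_of_int k + t * real_of_int l)) *\<^sub>C (U ^\<^sub>u k * V ^\<^sub>u l)" for k l
    unfolding \<psi>.hom_mult \<psi>.hom_unitary_power U V
    by (simp add: cis_scaleC_unitary_power mult_scaleC_left mult_scaleC_right scaleC_scaleC
        cis_mult algebra_simps)
  fix \<phi>
  assume \<phi>: "star_automorphism \<phi> \<and> (\<forall>k l. \<phi> (U ^\<^sub>u k * V ^\<^sub>u l)
      = cis (- (s * real_of_int k + t * real_of_int l)) *\<^sub>C (U ^\<^sub>u k * V ^\<^sub>u l))"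
  then have eq: "\<phi> (U ^\<^sub>u k * V ^\<^sub>u l) = ?\<psi> (U ^\<^sub>u k * V ^\<^sub>u l)" for k l
    unfolding mono by blast
  show "\<phi> = ?\<psi>"
  proof (rule star_endomorphism_eqI[OF _ \<psi>.star_endomorphism_axioms generated])
    show "star_endomorphism \<phi>"
      using \<phi> by (simp add: star_endomorphism_def star_automorphism_def)
    \<comment> \<open>The generators are the monomials with exponents (1, 0) and (0, 1).\<close>
    show "\<phi> x = ?\<psi> x" if "x \<in> {U, V}" for x
      using that eq[of 1 0] eq[of 0 1] by (auto simp: unitary_power_0 unitary_power_1)
  qed
qed

end

theorem theorem5p2:
  fixes \<theta> :: real and U V a :: "'a::cstar_algebra" and k1 k2 :: int
  assumes "quantum_torus \<theta> U V"
  shows "first_order_form (U ^\<^sub>u k1 * V ^\<^sub>u k2) a =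
      ((U ^\<^sub>u k1 * V ^\<^sub>u k2) *
        (a - torus_action U V (- real_of_int k2 * \<theta>) (real_of_int k1 * \<theta>) a)) \<bullet>\<^sub>f d_basis
    + (star (U ^\<^sub>u k1 * V ^\<^sub>u k2) *
        (a - torus_action U V (real_of_int k2 * \<theta>) (- real_of_int k1 * \<theta>) a)) \<bullet>\<^sub>f d_basis_star"
proof -
  interpret quantum_torus \<theta> U V by fact
  have U: "unitary U" and V: "unitary V"
    using unitary_U unitary_V by (simp_all add: unitary_in_cstar_UNIV)
  define W where "W = U ^\<^sub>u k1 * V ^\<^sub>u k2"
  have W: "unitary W"
    unfolding W_def by (intro unitary_mult unitary_unitary_power U V)
  \<comment> \<open>Each generator passes its own powers with phase 0, so only the power of the
    other generator contributes a phase when \<open>U\<close> or \<open>V\<close> moves past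
    \<open>W\<close>.\<close>
  have "U * U = cis 0 *\<^sub>C (U * U)" and "V * V = cis 0 *\<^sub>C (V * V)" by simp_all
  note UU = phase_commute_unitary_power[OF U this(1), of k1]
    and VV = phase_commute_unitary_power[OF V this(2), of k2]
  have UW: "U * W = cis (of_int k2 * \<theta>) *\<^sub>C (W * U)"
    using phase_commute_mult[OF UU phase_commute_unitary_power[OF V commutation, of k2]]
    by (simp add: W_def)
  have VW: "V * W = cis (- (of_int k1 * \<theta>)) *\<^sub>C (W * V)"
    using phase_commute_mult[OF phase_commute_unitary_power[OF U
          phase_commute_sym[OF commutation], of k1] VV]
    by (simp add: W_def)
  have "torus_action U V (- of_int k2 * \<theta>) (of_int k1 * \<theta>) = (\<lambda>x. star W * x * W)"
    by (rule torus_action_eq_conj[OF W]) (simp_all add: UW VW)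
  \<comment> \<open>Replacing \<open>W\<close> by \<open>star W\<close> inverts both phases, hence
    negates both parameters.\<close>
  moreover have "torus_action U V (of_int k2 * \<theta>) (- of_int k1 * \<theta>)
      = (\<lambda>x. star (star W) * x * star W)"
    by (rule torus_action_eq_conj[OF unitary_star[OF W]])
      (simp_all add: phase_commute_star[OF W UW] phase_commute_star[OF W VW])
  \<comment> \<open>The first cancellation turns the coefficient of \<open>d_basis\<close> into
    \<open>commutator W a\<close>; the second does the same for \<open>star W\<close> and
    \<open>d_basis_star\<close>.\<close>
  moreover have "W * (star W * x) = x" "star W * (W * x) = x" for x
    using W by (simp_all add: unitary_def flip: mult.assoc)
  ultimately show ?thesis
    unfolding W_def[symmetric]
    by (simp add: first_order_form_def commutator_def form_scale_def d_basis_def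
        d_basis_star_def right_diff_distrib star_star mult.assoc)
qed

end
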